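(* Let $\{\alpha_i\}_{i=0}^\infty$ be a discrete multiplier sequence (of real numbers). If $\alpha_{m+2}>0$ for some integer $m\ge 0$, then $\alpha_m\le\alpha_{m+1}$.
   Context: A polynomial in $\mathbb{R}[x]$ is called hyperbolic if all its zeros are real. For a hyperbolic $p$, $\operatorname{mesh}(p)$ is the minimal distance between its roots; if $p$ has a multiple root, then $\operatorname{mesh}(p):=0$; polynomials of degree at most $1$ are defined to have mesh $+\infty$. $\mathcal{HP}^{+}_{\ge 1}$ denotes the set of hyperbolic polynomials with mesh at least $1$ and with only non-negative zeros; by convention the zero polynomial and the nonzero constants belong to it. The Pochhammer polynomials are $(x)_0=1$, $(x)_i=x(x-1)\cdots(x-i+1)$ for $i\ge 1$. A real sequence $\{\alpha_i\}_{i=0}^\infty$ is called a discrete multiplier sequence if the linear operator $T:\mathbb{R}[x]\to\mathbb{R}[x]$ determined by $T((x)_i)=\alpha_i (x)_i$ for all $i\ge 0$ satisfies $T(\mathcal{HP}^{+}_{\ge 1})\subseteq\mathcal{HP}^{+}_{\ge 1}$. *)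

theory Defs
  imports
    Complex_Main
    "HOL-Library.Extended_Real"
    "HOL-Computational_Algebra.Polynomial"
begin

(* The zero polynomial does not satisfy this predicate, since every complex number is a zero. *)
definition hyperbolic :: "real poly \<Rightarrow> bool" where
  "hyperbolic p \<longleftrightarrow> (\<forall>z::complex. poly (map_poly complex_of_real p) z = 0 \<longrightarrow> z \<in> \<real>)"

(* Only meaningful for hyperbolic p. In the last case such a p has finitely many and
   at least two real roots, so the infimum is a minimum. *)
definition mesh :: "real poly \<Rightarrow> ereal" where
  "mesh p =
    (if degree p \<le> 1 then \<infinity>
     else if \<exists>x. order x p \<ge> 2 then 0
     else Inf {ereal \<bar>x - y\<bar> | x y. poly p x = 0 \<and> poly p y = 0 \<and> x \<noteq> y})"

(* Nonzero constants belong to the second set: they are hyperbolic, have infinite mesh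
   and no zeros. *)
definition HP_plus_ge1 :: "real poly set" where
  "HP_plus_ge1 =
    {0} \<union> {p. p \<noteq> 0 \<and> hyperbolic p \<and> mesh p \<ge> 1 \<and> (\<forall>x. poly p x = 0 \<longrightarrow> x \<ge> 0)}"

(* The falling factorial x (x - 1) ... (x - i + 1); the constant pochhammer of the
   library is the rising one. *)
definition pochhammer_poly :: "nat \<Rightarrow> real poly" where
  "pochhammer_poly i = (\<Prod>j<i. [:- real j, 1:])"

definition pochhammer_diagonal :: "(nat \<Rightarrow> real) \<Rightarrow> (real poly \<Rightarrow> real poly) \<Rightarrow> bool" where
  "pochhammer_diagonal \<alpha> T \<longleftrightarrow>
    Vector_Spaces.linear smult smult T \<and>
    (\<forall>i. T (pochhammer_poly i) = smult (\<alpha> i) (pochhammer_poly i))"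

(* The operator T exists and is unique for every sequence: lemma ex1_pochhammer_diagonal. *)
definition discrete_multiplier_sequence :: "(nat \<Rightarrow> real) \<Rightarrow> bool" where
  "discrete_multiplier_sequence \<alpha> \<longleftrightarrow>
    (\<exists>T. pochhammer_diagonal \<alpha> T \<and> T ` HP_plus_ge1 \<subseteq> HP_plus_ge1)"

lemma pochhammer_poly_Suc: "pochhammer_poly (Suc i) = pochhammer_poly i * [:- real i, 1:]"
  by (simp add: pochhammer_poly_def)

lemma degree_pochhammer_poly: "degree (pochhammer_poly i) = i"
  by (simp add: pochhammer_poly_def degree_prod_eq_sum_degree del: prod_constant)

lemma coeff_pochhammer_poly: "coeff (pochhammer_poly i) i = 1"
proof -
  have "lead_coeff (pochhammer_poly i) = 1"
    by (simp add: pochhammer_poly_def lead_coeff_prod)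
  then show ?thesis unfolding degree_pochhammer_poly .
qed

interpretation real_poly: vector_space "smult :: real \<Rightarrow> real poly \<Rightarrow> real poly"
  by unfold_locales (simp_all add: smult_add_left smult_add_right)

interpretation real_poly_pair: vector_space_pair
    "smult :: real \<Rightarrow> real poly \<Rightarrow> real poly" "smult :: real \<Rightarrow> real poly \<Rightarrow> real poly"
  by unfold_locales

lemma inj_pochhammer_poly: "inj pochhammer_poly"
  by (metis injI degree_pochhammer_poly)

lemma pochhammer_poly_sum_eq_0:
  assumes "(\<Sum>i\<le>n. smult (c i) (pochhammer_poly i)) = 0" "i \<le> n"
  shows "c i = 0"
  using assms
proof (induction n)
  case 0
  then show ?case by (simp add: pochhammer_poly_def)
next
  case (Suc n)
  have "coeff (\<Sum>i\<le>Suc n. smult (c i) (pochhammer_poly i)) (Suc n) =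
      (\<Sum>i\<le>n. c i * coeff (pochhammer_poly i) (Suc n)) + c (Suc n)"
    by (simp add: coeff_sum coeff_pochhammer_poly)
  also have "(\<Sum>i\<le>n. c i * coeff (pochhammer_poly i) (Suc n)) = 0"
    by (intro sum.neutral) (auto intro!: coeff_eq_0 simp: degree_pochhammer_poly)
  finally have "c (Suc n) = 0" unfolding Suc.prems(1) by simp
  with Suc show ?case by (cases "i = Suc n") auto
qed

lemma independent_pochhammer_poly: "\<not> real_poly.dependent (range pochhammer_poly)"
proof
  assume "real_poly.dependent (range pochhammer_poly)"
  then obtain t u v where t: "finite t" "t \<subseteq> range pochhammer_poly"
    "(\<Sum>v\<in>t. smult (u v) v) = 0" "v \<in> t" "u v \<noteq> 0"
    unfolding real_poly.dependent_explicit by blast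
  from t(1,2) obtain I where I: "finite I" "t = pochhammer_poly ` I"
    by (meson finite_subset_image)
  then obtain n where n: "I \<subseteq> {..n}"
    by (meson finite_nat_iff_bounded_le)
  define c where "c i = (if i \<in> I then u (pochhammer_poly i) else 0)" for i
  have "(\<Sum>i\<le>n. smult (c i) (pochhammer_poly i)) =
      (\<Sum>i\<in>I. smult (u (pochhammer_poly i)) (pochhammer_poly i))"
    by (rule sum.mono_neutral_cong_right) (use n in \<open>auto simp: c_def\<close>)
  also have "\<dots> = (\<Sum>v\<in>t. smult (u v) v)"
    unfolding I(2) by (subst sum.reindex) (auto intro: inj_on_subset[OF inj_pochhammer_poly])
  finally have sum0: "(\<Sum>i\<le>n. smult (c i) (pochhammer_poly i)) = 0" using t(3) by simp
  from t(4) I obtain i where i: "i \<in> I" "v = pochhammer_poly i" by auto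
  with n pochhammer_poly_sum_eq_0[OF sum0, of i] t(5) show False by (auto simp: c_def)
qed

lemma span_pochhammer_poly: "real_poly.span (range pochhammer_poly) = UNIV"
proof -
  have "p \<in> real_poly.span (range pochhammer_poly)" if "\<forall>i\<ge>n. coeff p i = 0" for p n
    using that
  proof (induction n arbitrary: p)
    case 0
    then have "p = 0" by (simp add: poly_eq_iff)
    then show ?case by (simp add: real_poly.span_zero)
  next
    case (Suc n)
    define q where "q = p - smult (coeff p n) (pochhammer_poly n)"
    have "coeff q i = 0" if "i \<ge> n" for i
      using Suc.prems that
      by (cases "i = n")
        (auto simp: q_def coeff_pochhammer_poly degree_pochhammer_poly coeff_eq_0)
    then have "q \<in> real_poly.span (range pochhammer_poly)" using Suc.IH by blast
    moreover have "p = q + smult (coeff p n) (pochhammer_poly n)" by (simp add: q_def)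
    ultimately show ?case
      by (metis rangeI real_poly.span_add real_poly.span_base real_poly.span_scale)
  qed
  moreover have "\<forall>i\<ge>Suc (degree p). coeff p i = 0" for p :: "real poly"
    by (auto intro: coeff_eq_0)
  ultimately show ?thesis by blast
qed

lemma ex1_pochhammer_diagonal: "\<exists>!T. pochhammer_diagonal \<alpha> T"
proof (rule ex_ex1I)
  show "\<exists>T. pochhammer_diagonal \<alpha> T"
    using real_poly_pair.linear_independent_extend[OF independent_pochhammer_poly,
      of "\<lambda>b. smult (\<alpha> (degree b)) b"]
    by (auto simp: pochhammer_diagonal_def degree_pochhammer_poly)
next
  fix S T
  assume S: "pochhammer_diagonal \<alpha> S" and T: "pochhammer_diagonal \<alpha> T"
  show "S = T"
  proof
    fix p
    have lin: "Vector_Spaces.linear smult smult S" "Vector_Spaces.linear smult smult T"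
      using S T unfolding pochhammer_diagonal_def by blast+
    have eq: "S b = T b" if "b \<in> range pochhammer_poly" for b
      using S T that unfolding pochhammer_diagonal_def by force
    have "p \<in> real_poly.span (range pochhammer_poly)"
      by (simp only: span_pochhammer_poly UNIV_I)
    from real_poly_pair.linear_eq_on[OF lin this eq] show "S p = T p" .
  qed
qed

end

theory Submission
  imports Defs
begin

text \<open>
  The polynomial \<open>(x)\<^sub>m (x - m - e) (x - m - 1 - e)\<close> with \<open>e > 0\<close> has two roots at distance
  exactly 1, so it lies on the boundary of the condition on the mesh; at \<open>e = 0\<close> it is
  \<open>(x)\<^bsub>m+2\<^esub>\<close>, an eigenvector of \<open>T\<close>.  Written with \<open>y = x - m\<close>, the quadratic factor is
  \<open>y (y - 1) - 2 e y + e (1 + e)\<close>, so \<open>T\<close> keeps the factor \<open>(x)\<^sub>m\<close> and turns the quadratic into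
  \<open>A y (y - 1) - 2 e B y + e (1 + e) C\<close>, where \<open>C\<close>, \<open>B\<close>, \<open>A\<close> are the multipliers with
  indices \<open>m\<close>, \<open>m + 1\<close>, \<open>m + 2\<close>.  The image has mesh at least 1, so the roots of this quadratic
  are real and at least 1 apart: its discriminant is at least \<open>A\<^sup>2\<close>
  (lemma \<open>quadratic_factor_discriminant\<close>).  The terms \<open>A\<^sup>2\<close> cancel, and what remains, divided by
  \<open>4 e\<close>, is \<open>A C (1 + e) \<le> A B + e B\<^sup>2\<close>.  Letting \<open>e\<close> tend to 0 and dividing by \<open>A > 0\<close> gives
  \<open>C \<le> B\<close>.  At \<open>e = 0\<close> the discriminant equals \<open>A\<^sup>2\<close>, so the inequality is the condition
  that it does not decrease to first order in \<open>e\<close>.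
\<close>

lemma poly_map_of_real_mult:
  "poly (map_poly complex_of_real (p * q)) z =
    poly (map_poly complex_of_real p) z * poly (map_poly complex_of_real q) z"
proof -
  have "map_poly complex_of_real (p * q) =
      map_poly complex_of_real p * map_poly complex_of_real q"
    by (rule poly_eqI) (simp add: coeff_map_poly coeff_mult)
  then show ?thesis by simp
qed

lemma poly_map_of_real_prod_linear:
  assumes "finite S"
  shows "poly (map_poly complex_of_real (\<Prod>s\<in>S. [:- s, 1:])) z = (\<Prod>s\<in>S. z - complex_of_real s)"
  using assms
  by (induction S rule: finite_induct)
    (simp_all add: poly_map_of_real_mult map_poly_pCons del: mult_pCons_left)

lemma order_prod_linear_le_1:
  fixes S :: "real set"
  assumes "finite S"
  shows "order x (\<Prod>s\<in>S. [:- s, 1:]) \<le> 1"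
proof (cases "x \<in> S")
  case True
  let ?q = "\<Prod>s\<in>S - {x}. [:- s, 1:]"
  have split: "(\<Prod>s\<in>S. [:- s, 1:]) = [:- x, 1:] * ?q"
    using assms True by (rule prod.remove)
  have q: "poly ?q x \<noteq> 0"
    using assms by (simp add: poly_prod)
  then have nz: "[:- x, 1:] * ?q \<noteq> 0" by (auto simp del: mult_pCons_left)
  have "order x [:- x, 1:] = 1"
    using order_power_n_n[of x 1] by simp
  then show ?thesis
    unfolding split order_mult[OF nz] using order_0I[OF q] by simp
next
  case False
  have "poly (\<Prod>s\<in>S. [:- s, 1:]) x \<noteq> 0"
    using assms False by (auto simp: poly_prod)
  then show ?thesis by (simp add: order_0I)
qed

lemma prod_linear_in_HP_plus_ge1:
  fixes S :: "real set"
  assumes fin: "finite S" and nonneg: "\<And>s. s \<in> S \<Longrightarrow> s \<ge> 0"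
    and sep: "\<And>s t. s \<in> S \<Longrightarrow> t \<in> S \<Longrightarrow> s \<noteq> t \<Longrightarrow> \<bar>s - t\<bar> \<ge> 1"
  shows "(\<Prod>s\<in>S. [:- s, 1:]) \<in> HP_plus_ge1"
proof -
  let ?p = "\<Prod>s\<in>S. [:- s, 1:]"
  have roots: "poly ?p x = 0 \<longleftrightarrow> x \<in> S" for x
    using fin by (auto simp: poly_prod)
  have "?p \<noteq> 0" using fin by simp
  moreover have "hyperbolic ?p"
    using fin by (auto simp: hyperbolic_def poly_map_of_real_prod_linear)
  moreover have "mesh ?p \<ge> 1"
  proof -
    have "\<not> (\<exists>x. order x ?p \<ge> 2)"
      using order_prod_linear_le_1[OF fin] by (metis Suc_1 not_less_eq_eq One_nat_def)
    moreover have "1 \<le> Inf {ereal \<bar>x - y\<bar> | x y. poly ?p x = 0 \<and> poly ?p y = 0 \<and> x \<noteq> y}"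
      unfolding roots by (rule Inf_greatest) (use sep in \<open>auto simp: one_ereal_def\<close>)
    ultimately show ?thesis by (simp add: mesh_def)
  qed
  ultimately show ?thesis
    using nonneg roots by (simp add: HP_plus_ge1_def)
qed

text \<open>
  A quadratic with discriminant \<open>D\<close> and leading coefficient \<open>a\<close> has roots \<open>sqrt D / \<bar>a\<bar>\<close>
  apart.  So if the bound failed, the product would have a non-real root, a double root, or two
  distinct roots at distance less than 1.
\<close>
lemma quadratic_factor_discriminant:
  fixes a b c :: real
  assumes HP: "r * [:c, b, a:] \<in> HP_plus_ge1" and r: "r \<noteq> 0" and a: "a \<noteq> 0"
  shows "b\<^sup>2 - 4 * a * c \<ge> a\<^sup>2"
proof -
  define D where "D = b\<^sup>2 - 4 * a * c"
  let ?p = "r * [:c, b, a:]"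
  have p: "?p \<noteq> 0" using r a by (simp del: mult_pCons_right)
  have hyp: "hyperbolic ?p" and mesh: "mesh ?p \<ge> 1"
    using HP p by (auto simp: HP_plus_ge1_def)
  have deg: "\<not> degree ?p \<le> 1"
    using r a by (simp add: degree_mult_eq del: mult_pCons_right)
  have simple: "order x ?p < 2" for x
    using mesh deg by (auto simp: mesh_def split: if_splits simp: not_le)
  have dist: "\<bar>x - y\<bar> \<ge> 1" if "poly ?p x = 0" "poly ?p y = 0" "x \<noteq> y" for x y
  proof -
    have "mesh ?p \<le> ereal \<bar>x - y\<bar>"
      using deg simple that unfolding mesh_def
      by (auto simp: not_le intro!: Inf_lower)
    with mesh have "1 \<le> ereal \<bar>x - y\<bar>" by (rule order_trans)
    then show ?thesis by (simp add: one_ereal_def)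
  qed
  have "D \<ge> 0"
  proof (rule ccontr)
    assume "\<not> D \<ge> 0"
    define w where "w = sqrt (- D)"
    have "w \<noteq> 0" using \<open>\<not> D \<ge> 0\<close> by (simp add: w_def)
    have "w\<^sup>2 = 4 * a * c - b\<^sup>2" using \<open>\<not> D \<ge> 0\<close> by (simp add: w_def D_def)
    then have c: "c = (w\<^sup>2 + b\<^sup>2) / (4 * a)" using a by (simp add: field_simps)
    define z where "z = Complex (- b / (2 * a)) (w / (2 * a))"
    have "poly (map_poly complex_of_real [:c, b, a:]) z = 0"
      using a by (simp add: map_poly_pCons z_def complex_eq_iff c field_simps power2_eq_square)
    then have "z \<in> \<real>"
      using hyp unfolding hyperbolic_def poly_map_of_real_mult by simp
    then show False using \<open>w \<noteq> 0\<close> a by (simp add: z_def complex_is_Real_iff)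
  qed
  define w where "w = sqrt D"
  define u where "u = (- b + w) / (2 * a)"
  define v where "v = (- b - w) / (2 * a)"
  have w: "w\<^sup>2 = D" using \<open>D \<ge> 0\<close> by (simp add: w_def)
  then have c: "c = (b\<^sup>2 - w\<^sup>2) / (4 * a)" using a by (simp add: D_def field_simps)
  have sum: "a * (u + v) = - b" and uv: "a * (u * v) = c"
    using a by (simp_all add: u_def v_def c field_simps power2_eq_square)
  have factor: "[:c, b, a:] = smult a ([:- u, 1:] * [:- v, 1:])"
    using sum uv by (simp add: algebra_simps)
  have "u \<noteq> v"
  proof
    assume "u = v"
    then have "[:- u, 1:] ^ 2 dvd ?p"
      unfolding factor by (simp add: power2_eq_square dvd_smult del: mult_pCons_left mult_pCons_right)
    then have "order u ?p \<ge> 2"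
      using p order_divides by blast
    then show False using simple[of u] by simp
  qed
  then have "\<bar>u - v\<bar> \<ge> 1"
    by (intro dist) (simp_all only: factor poly_mult poly_smult, simp_all)
  then have "1 \<le> (u - v)\<^sup>2"
    using abs_le_square_iff[of 1 "u - v"] by simp
  also have "(u - v)\<^sup>2 = D / a\<^sup>2"
    using a w[symmetric] by (simp add: u_def v_def field_simps power2_eq_square)
  finally show ?thesis using a by (simp add: D_def field_simps)
qed

theorem proposition13:
  fixes \<alpha> :: "nat \<Rightarrow> real" and m :: nat
  assumes "discrete_multiplier_sequence \<alpha>"
    and "\<alpha> (m + 2) > 0"
  shows "\<alpha> m \<le> \<alpha> (m + 1)"
proof -
  obtain T where lin: "Vector_Spaces.linear smult smult T"
    and diag: "\<And>i. T (pochhammer_poly i) = smult (\<alpha> i) (pochhammer_poly i)"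
    and pres: "T ` HP_plus_ge1 \<subseteq> HP_plus_ge1"
    using assms(1) by (auto simp: discrete_multiplier_sequence_def pochhammer_diagonal_def)
  define A B C where "A = \<alpha> (m + 2)" and "B = \<alpha> (m + 1)" and "C = \<alpha> m"
  have A: "A > 0" using assms(2) by (simp add: A_def)
  let ?r = "pochhammer_poly m"
  have r: "?r \<noteq> 0" using coeff_pochhammer_poly[of m] by auto
  have Suc1: "pochhammer_poly (m + 1) = ?r * [:- real m, 1:]"
    by (simp add: pochhammer_poly_Suc)
  have Suc2: "pochhammer_poly (m + 2) = ?r * ([:- real m, 1:] * [:- real (m + 1), 1:])"
    using pochhammer_poly_Suc[of "m + 1"] unfolding Suc1
    by (simp add: mult.assoc del: mult_pCons_left mult_pCons_right)

  have ineq: "A * C * (1 + e) \<le> A * B + e * B\<^sup>2" if e: "e > 0" for e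
  proof -
    \<comment> \<open>The roots of \<open>(x)\<^sub>m (x - m - e) (x - m - 1 - e)\<close>; the gap between the last two is 1.\<close>
    define S where "S = insert (m + e) (insert (m + 1 + e) (real ` {..<m}))"
    define p where "p = (\<Prod>s\<in>S. [:- s, 1:])"
    have "p \<in> HP_plus_ge1"
      unfolding p_def
    proof (rule prod_linear_in_HP_plus_ge1)
      have nat_sep: "1 \<le> \<bar>real i - real j\<bar>" if "i \<noteq> j" for i j
        using that by (cases "i < j") (auto simp: abs_if)
      have below: "real i + 1 \<le> real m" if "i < m" for i
        using that by linarith
      show "\<bar>s - t\<bar> \<ge> 1" if "s \<in> S" "t \<in> S" "s \<noteq> t" for s t
        using that e nat_sep
        by (auto simp: S_def dest!: below)
    qed (use e in \<open>auto simp: S_def\<close>)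
    then have Tp: "T p \<in> HP_plus_ge1" using pres by blast
    have "p = ?r * ([:- (m + e), 1:] * [:- (m + 1 + e), 1:])"
    proof -
      have "m + e \<notin> insert (m + 1 + e) (real ` {..<m})" "m + 1 + e \<notin> real ` {..<m}"
        using e by auto
      then have "p = [:- (m + e), 1:] * ([:- (m + 1 + e), 1:] * (\<Prod>s\<in>real ` {..<m}. [:- s, 1:]))"
        unfolding p_def S_def by (simp del: mult_pCons_left mult_pCons_right)
      also have "(\<Prod>s\<in>real ` {..<m}. [:- s, 1:]) = ?r"
        by (simp add: pochhammer_poly_def prod.reindex)
      finally show ?thesis by (simp only: ac_simps)
    qed
    also have "[:- (m + e), 1:] * [:- (m + 1 + e), 1:] =
        [:- real m, 1:] * [:- real (m + 1), 1:] +
        smult (- 2 * e) [:- real m, 1:] + smult (e * (1 + e)) 1"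
      by (simp add: algebra_simps)
    finally have "p = pochhammer_poly (m + 2) + smult (- 2 * e) (pochhammer_poly (m + 1)) +
        smult (e * (1 + e)) ?r"
      unfolding Suc1 Suc2
      by (simp only: distrib_left mult_smult_right mult_1_right)
    then have "T p = smult A (pochhammer_poly (m + 2)) +
        smult (- 2 * e) (smult B (pochhammer_poly (m + 1))) + smult (e * (1 + e)) (smult C ?r)"
      by (simp only: real_poly_pair.linear_add[OF lin] real_poly_pair.linear_scale[OF lin]
          diag A_def B_def C_def)
    also have "\<dots> = ?r * [:A * m * (m + 1) + 2 * e * B * m + e * (1 + e) * C,
        - A * (2 * m + 1) - 2 * e * B, A:]"
    proof -
      have "[:A * m * (m + 1) + 2 * e * B * m + e * (1 + e) * C, - A * (2 * m + 1) - 2 * e * B, A:]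
          = smult A ([:- real m, 1:] * [:- real (m + 1), 1:]) +
            smult (- 2 * e) (smult B [:- real m, 1:]) + smult (e * (1 + e)) (smult C 1)"
        by (simp add: algebra_simps)
      then show ?thesis
        unfolding Suc1 Suc2
        by (simp only: distrib_left mult_smult_right mult_1_right)
    qed
    finally have "A\<^sup>2 \<le> (- A * (2 * m + 1) - 2 * e * B)\<^sup>2 -
        4 * A * (A * m * (m + 1) + 2 * e * B * m + e * (1 + e) * C)"
      using quadratic_factor_discriminant[OF _ r] A Tp by simp
    then have "(4 * e) * (A * C * (1 + e)) \<le> (4 * e) * (A * B + e * B\<^sup>2)"
      by (simp add: algebra_simps power2_eq_square)
    then show ?thesis using e by simp
  qed

  have "((\<lambda>e. A * C * (1 + e)) \<longlongrightarrow> A * C * (1 + 0)) (at_right 0)"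
    "((\<lambda>e. A * B + e * B\<^sup>2) \<longlongrightarrow> A * B + 0 * B\<^sup>2) (at_right 0)"
    by (intro tendsto_intros)+
  moreover have "\<forall>\<^sub>F e in at_right 0. A * C * (1 + e) \<le> A * B + e * B\<^sup>2"
    using ineq by (auto simp: eventually_at_right_less intro: eventually_at_rightI[of 0 1])
  ultimately have "A * C * (1 + 0) \<le> A * B + 0 * B\<^sup>2"
    by (intro tendsto_le[of "at_right 0"]) auto
  then show ?thesis using A by (simp add: B_def C_def)
qed

end
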